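(* Fix $m,p\in\mathbb{N}$. Let $x=(x_i)_{i\in\mathbb{N}_0}$ and $y=(y_i)_{i\in\mathbb{N}_0}$ be non-decreasing sequences of non-negative integers. Then the following are equivalent: (i) $(x_i)_{i\in\mathbb{N}_0}$ and $(y_i)_{i\in\mathbb{N}}$ are $p$-complementary on $\mathbb{N}_0$, and $y_n-x_n=mn$ for all $n\in\mathbb{N}_0$; (ii) for all $n\in\mathbb{N}_0$, $x_n=\lfloor n\phi_{mp}/p\rfloor$ and $y_n=\lfloor n(\phi_{mp}+mp)/p\rfloor$, where $\phi_k=\frac{2-k+\sqrt{k^2+4}}{2}$.
   Context: $\mathbb{N}=\{1,2,\dots\}$, $\mathbb{N}_0=\{0,1,2,\dots\}$. Two sequences $(x_i)_{i\in Q}$, $(y_i)_{i\in R}$ of non-negative integers are $p$-complementary on $\mathbb{N}_0$ if for each $n\in\mathbb{N}_0$, $\#\{i\in Q:x_i=n\}+\#\{i\in R:y_i=n\}=p$. *)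

theory Defs
  imports Complex_Main
begin

text \<open>
  The finiteness conditions are needed because \<open>card\<close> of an infinite set is 0: a value taken
  infinitely often has infinite multiplicity, so the total there is not \<open>p\<close>.
\<close>

definition p_complementary ::
  "nat \<Rightarrow> 'i set \<Rightarrow> ('i \<Rightarrow> nat) \<Rightarrow> 'j set \<Rightarrow> ('j \<Rightarrow> nat) \<Rightarrow> bool" where
  "p_complementary p Q x R y \<longleftrightarrow>
     (\<forall>n. finite {i \<in> Q. x i = n} \<and> finite {i \<in> R. y i = n} \<and>
          card {i \<in> Q. x i = n} + card {i \<in> R. y i = n} = p)"

definition phi :: "nat \<Rightarrow> real" where
  "phi k = (2 - real k + sqrt ((real k)\<^sup>2 + 4)) / 2"

end

theory Submission
  imports Defs
begin

text \<open>
  Put \<open>k = m * p\<close>. Since \<open>1 / phi k + 1 / (phi k + k) = 1\<close> and \<open>phi k\<close> is irrational, Beatty's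
  counting argument makes the two floor sequences \<open>p\<close>-complementary. Conversely, the
  complementarity condition and the differences \<open>m * n\<close> determine both sequences recursively.
\<close>

text \<open>A rational square root of a natural number is an integer. For \<open>k \<ge> 1\<close>
  the number lies strictly between the squares of \<open>k\<close> and \<open>k + 2\<close>, so it
  would be the square of \<open>k + 1\<close>, which fails by parity.\<close>

lemma sqrt_sq_plus_4_irrational:
  assumes "k \<ge> 1"
  shows "sqrt ((real k)\<^sup>2 + 4) \<notin> \<rat>"
proof
  assume "sqrt ((real k)\<^sup>2 + 4) \<in> \<rat>"
  then obtain a b :: nat where ab: "b \<noteq> 0" "\<bar>sqrt ((real k)\<^sup>2 + 4)\<bar> = real a / real b" "coprime a b"
    by (rule Rats_abs_nat_div_natE)
  have "(real a / real b)\<^sup>2 = (real k)\<^sup>2 + 4"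
    unfolding ab(2)[symmetric] by simp
  then have "real (a\<^sup>2) = real ((k\<^sup>2 + 4) * b\<^sup>2)"
    using ab(1) by (simp add: field_simps)
  then have eq: "a\<^sup>2 = (k\<^sup>2 + 4) * b\<^sup>2"
    by (simp only: of_nat_eq_iff)
  have "coprime (b\<^sup>2) (a\<^sup>2)"
    using ab(3) by (simp add: coprime_commute)
  moreover have "b\<^sup>2 dvd a\<^sup>2"
    by (simp add: eq)
  ultimately have "b\<^sup>2 = 1"
    by (metis coprime_common_divisor_nat dvd_refl)
  then have square: "a\<^sup>2 = k\<^sup>2 + 4"
    using eq by simp
  have "k < a"
    by (rule power_less_imp_less_base[of _ 2]) (simp_all add: square)
  moreover have "a < k + 2"
  proof (rule power_less_imp_less_base[of _ 2])
    have "(k + 2)\<^sup>2 = k\<^sup>2 + 4 * k + 4"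
      by (simp add: power2_eq_square algebra_simps)
    then show "a\<^sup>2 < (k + 2)\<^sup>2"
      using assms square by linarith
  qed simp
  ultimately have "a = k + 1" by simp
  then have "2 * k = 3"
    using square by (simp add: power2_eq_square)
  then show False by presburger
qed

text \<open>Reflection at \<open>N\<close> turns a ceiling into a floor, and for a non-integer the
  two differ by exactly 1.\<close>

lemma ceiling_add_complement:
  fixes u v :: real
  assumes "u + v = of_int N" and "u \<notin> \<int>"
  shows "\<lceil>u\<rceil> + \<lceil>v\<rceil> = N + 1"
proof -
  have "v = of_int N - u" using assms by simp
  then have "\<lceil>v\<rceil> = N - \<lfloor>u\<rfloor>"
    by (simp add: ceiling_def)
  moreover have "\<lceil>u\<rceil> = \<lfloor>u\<rfloor> + 1"
    using assms(2) by (metis ceiling_altdef Ints_of_int)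
  ultimately show ?thesis by simp
qed

text \<open>The fibre consists of the integers in \<open>[n * c, (n + 1) * c)\<close>. Ceilings as
  endpoints make multiplicities differences of consecutive terms.\<close>

lemma floor_divide_fibre:
  fixes c :: real
  assumes "c > 0"
  shows "{i. \<lfloor>real i / c\<rfloor> = int n} = {nat \<lceil>real n * c\<rceil>..<nat \<lceil>real (Suc n) * c\<rceil>}"
proof -
  have "\<lfloor>real i / c\<rfloor> = int n \<longleftrightarrow> real n * c \<le> real i \<and> real i < real (Suc n) * c" for i
    using assms by (simp add: floor_eq_iff field_simps)
  moreover have "i < nat \<lceil>r\<rceil> \<longleftrightarrow> real i < r" for i and r :: real
    by (metis nat_ceiling_le_eq not_le)
  ultimately show ?thesis
    by (simp add: set_eq_iff nat_ceiling_le_eq del: of_nat_Suc)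
qed

text \<open>Counting the entries below \<open>j\<close> in both sequences together gives
  \<open>j * p\<close>; the multiplicity of \<open>n\<close> is the increment from
  \<open>j = n\<close> to \<open>j = n + 1\<close>.\<close>

lemma p_complementary_Beatty:
  fixes c d :: real
  assumes "c > 0" "d > 0" "c + d = real p" "c \<notin> \<rat>"
    and x: "\<And>i. int (x i) = \<lfloor>real i / c\<rfloor>"
    and y: "\<And>i. int (y i) = \<lfloor>real i / d\<rfloor>"
  shows "p_complementary p {0..} x {1..} y"
  unfolding p_complementary_def
proof (intro allI conjI)
  fix n
  \<comment> \<open>The \<open>max 1\<close> removes index 0 from the second sequence; it changes
    the endpoint only at 0.\<close>
  let ?a = "\<lambda>n. nat \<lceil>real n * c\<rceil>" and ?b = "\<lambda>n. max 1 (nat \<lceil>real n * d\<rceil>)"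
  have X: "{i \<in> {0..}. x i = n} = {?a n..<?a (Suc n)}"
    using floor_divide_fibre[OF \<open>c > 0\<close>, of n] by (auto simp flip: x)
  have Y: "{i \<in> {1..}. y i = n} = {?b n..<?b (Suc n)}"
  proof -
    have "{i \<in> {1..}. y i = n} = {1..} \<inter> {i. \<lfloor>real i / d\<rfloor> = int n}"
      by (auto simp flip: y)
    also have "\<dots> = {?b n..<?b (Suc n)}"
      unfolding floor_divide_fibre[OF \<open>d > 0\<close>] by auto
    finally show ?thesis .
  qed
  show "finite {i \<in> {0..}. x i = n}" "finite {i \<in> {1..}. y i = n}"
    unfolding X Y by simp_all
  \<comment> \<open>\<open>?a j\<close> counts the indices with \<open>x i < j\<close>, and
    \<open>?b j\<close> is one more than the number of positive indices with
    \<open>y i < j\<close>.\<close>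
  have total: "?a j + ?b j = j * p + 1" for j
  proof (cases "j = 0")
    case False
    have "real j * c \<notin> \<int>"
    proof
      assume "real j * c \<in> \<int>"
      then have "real j * c / real j \<in> \<rat>" by (meson Ints_subset_Rats Rats_divide Rats_of_nat subsetD)
      then show False using False \<open>c \<notin> \<rat>\<close> by simp
    qed
    moreover have "real j * c + real j * d = of_int (int (j * p))"
      using \<open>c + d = real p\<close> by (simp flip: distrib_left)
    ultimately have "\<lceil>real j * c\<rceil> + \<lceil>real j * d\<rceil> = int (j * p) + 1"
      by (intro ceiling_add_complement)
    moreover have "\<lceil>real j * c\<rceil> > 0" "\<lceil>real j * d\<rceil> > 0"
      using False assms(1,2) by simp_all
    ultimately show ?thesis by linarith
  qed simp
  \<comment> \<open>Monotonicity keeps the natural-number subtraction in the interval cardinalities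
    from truncating.\<close>
  have "?a n \<le> ?a (Suc n)" "?b n \<le> ?b (Suc n)"
    using assms(1,2) by (intro nat_mono ceiling_mono max.mono order_refl mult_right_mono; simp)+
  with total[of n] total[of "Suc n"]
  show "card {i \<in> {0..}. x i = n} + card {i \<in> {1..}. y i = n} = p"
    unfolding X Y card_atLeastLessThan by simp
qed

text \<open>
  At the first index where two solutions differ, the smaller new value \<open>x n\<close> is taken
  strictly more often by \<open>x\<close> than by \<open>x'\<close>, while \<open>y\<close> and \<open>y'\<close>, whose later entries exceed
  \<open>x n\<close> because \<open>m \<ge> 1\<close>, take it equally often.
\<close>
lemma p_complementary_not_less:
  fixes x x' y y' :: "nat \<Rightarrow> nat"
  assumes "m \<ge> 1" "mono x" "mono x'"
    and c: "p_complementary p {0..} x {1..} y" and c': "p_complementary p {0..} x' {1..} y'"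
    and y: "\<And>i. y i = x i + m * i" and y': "\<And>i. y' i = x' i + m * i"
    and agree: "\<And>i. i < n \<Longrightarrow> x i = x' i"
  shows "\<not> x n < x' n"
proof
  assume less: "x n < x' n"
  have gt: "x n < x' i" if "i \<ge> n" for i
    using less monoD[OF \<open>mono x'\<close> that] by simp
  \<comment> \<open>By \<open>gt\<close>, \<open>x'\<close> can take the value \<open>x n\<close>
    only before \<open>n\<close>, where both sequences agree; the index \<open>n\<close> itself
    makes the inclusion strict.\<close>
  have "{i \<in> {0..}. x' i = x n} \<subset> {i \<in> {0..}. x i = x n}"
  proof
    show "{i \<in> {0..}. x' i = x n} \<subseteq> {i \<in> {0..}. x i = x n}"
      using gt agree by (auto simp: not_le) (metis less_irrefl not_le)
    show "{i \<in> {0..}. x' i = x n} \<noteq> {i \<in> {0..}. x i = x n}"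
      using less by (metis (mono_tags, lifting) atLeast_iff le0 mem_Collect_eq less_irrefl)
  qed
  then have "card {i \<in> {0..}. x' i = x n} < card {i \<in> {0..}. x i = x n}"
    using c by (intro psubset_card_mono) (auto simp: p_complementary_def)
  moreover have "y' i = x n \<longleftrightarrow> y i = x n" if "i \<ge> 1" for i
  proof (cases "i < n")
    case True
    then show ?thesis by (simp add: y y' agree)
  next
    case False
    moreover have "m * i > 0" using that \<open>m \<ge> 1\<close> by simp
    ultimately show ?thesis
      using gt[of i] monoD[OF \<open>mono x\<close>, of n i] unfolding y y' by linarith
  qed
  then have "{i \<in> {1..}. y' i = x n} = {i \<in> {1..}. y i = x n}"
    by auto
  moreover have "card {i \<in> {0..}. x i = x n} + card {i \<in> {1..}. y i = x n} =
      card {i \<in> {0..}. x' i = x n} + card {i \<in> {1..}. y' i = x n}"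
    using c c' by (simp add: p_complementary_def)
  ultimately show False by simp
qed

text \<open>The hypotheses are symmetric in the two solutions, so the comparison at a first
  disagreement applies in both directions.\<close>

lemma p_complementary_unique:
  fixes x x' y y' :: "nat \<Rightarrow> nat"
  assumes "m \<ge> 1" "mono x" "mono x'"
    and "p_complementary p {0..} x {1..} y" "p_complementary p {0..} x' {1..} y'"
    and "\<And>i. y i = x i + m * i" "\<And>i. y' i = x' i + m * i"
  shows "x n = x' n"
proof (induction n rule: less_induct)
  case (less n)
  have "\<not> x n < x' n"
    by (rule p_complementary_not_less[OF assms less])
  moreover have "\<not> x' n < x n"
    by (rule p_complementary_not_less[OF assms(1,3,2,5,4,7,6) less[symmetric]])
  ultimately show ?case by simp
qed

lemma phi_pos: "phi k > 0"
proof -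
  have "real k < sqrt ((real k)\<^sup>2 + 4)" by (rule real_less_rsqrt) simp
  then show ?thesis unfolding phi_def by simp
qed

text \<open>Cleared of denominators, this is \<open>t * t + (k - 2) * t - k = 0\<close>, whose
  larger root is \<open>phi k\<close>.\<close>

lemma phi_inverse_sum: "1 / phi k + 1 / (phi k + real k) = 1"
proof -
  have "phi k + (phi k + real k) = phi k * (phi k + real k)"
    by (simp add: phi_def field_simps power2_eq_square)
  then show ?thesis
    using phi_pos[of k] by (simp add: field_simps)
qed

lemma phi_irrational:
  assumes "k \<ge> 1"
  shows "phi k \<notin> \<rat>"
proof
  assume "phi k \<in> \<rat>"
  then have "2 * phi k - 2 + real k \<in> \<rat>" by (intro Rats_add Rats_diff Rats_mult) auto
  then show False
    using sqrt_sq_plus_4_irrational[OF assms] by (simp add: phi_def add_divide_distrib diff_divide_distrib)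
qed

lemma p_complementary_floor_phi:
  assumes "m \<ge> 1" "p \<ge> 1"
    and x: "\<And>n. int (x n) = \<lfloor>real n * phi (m * p) / real p\<rfloor>"
    and y: "\<And>n. int (y n) = \<lfloor>real n * (phi (m * p) + real (m * p)) / real p\<rfloor>"
  shows "p_complementary p {0..} x {1..} y"
proof (rule p_complementary_Beatty)
  let ?f = "phi (m * p)"
  \<comment> \<open>Scaling the reciprocals by \<open>p\<close> turns their sum 1 into
    \<open>p\<close>, as the Beatty count requires.\<close>
  let ?c = "real p / ?f" and ?d = "real p / (?f + real (m * p))"
  show "?c > 0" "?d > 0"
    using phi_pos[of "m * p"] \<open>p \<ge> 1\<close> by (auto intro!: divide_pos_pos add_pos_nonneg)
  have "?c + ?d = real p * (1 / ?f + 1 / (?f + real (m * p)))"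
    by (simp add: distrib_left)
  then show "?c + ?d = real p"
    by (simp only: phi_inverse_sum)
  show "?c \<notin> \<rat>"
  proof
    assume "?c \<in> \<rat>"
    then have "real p / ?c \<in> \<rat>" by (rule Rats_divide[OF Rats_of_nat])
    moreover have "real p / ?c = ?f"
      using \<open>p \<ge> 1\<close> by simp
    ultimately show False
      using phi_irrational[of "m * p"] assms(1,2) by simp
  qed
  show "int (x i) = \<lfloor>real i / ?c\<rfloor>" "int (y i) = \<lfloor>real i / ?d\<rfloor>" for i
    unfolding x y by simp_all
qed

text \<open>The factor \<open>p\<close> cancels in the added term, leaving the integer
  \<open>m * n\<close>, which passes through the floor.\<close>

lemma floor_phi_difference:
  assumes "p \<ge> 1"
  shows "\<lfloor>real n * (phi (m * p) + real (m * p)) / real p\<rfloor> =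
    \<lfloor>real n * phi (m * p) / real p\<rfloor> + int (m * n)"
proof -
  have "real n * (phi (m * p) + real (m * p)) / real p =
      real n * phi (m * p) / real p + of_int (int (m * n))"
    using assms by (simp add: field_simps)
  then show ?thesis by (simp only: floor_add_int[symmetric])
qed

theorem theorem4p1:
  fixes m p :: nat and x y :: "nat \<Rightarrow> nat"
  assumes "m \<ge> 1" and "p \<ge> 1"
    and "mono x" and "mono y"
  shows "(p_complementary p {0..} x {1..} y \<and> (\<forall>n. int (y n) - int (x n) = int (m * n)))
     \<longleftrightarrow>
     (\<forall>n. int (x n) = \<lfloor>real n * phi (m * p) / real p\<rfloor> \<and>
          int (y n) = \<lfloor>real n * (phi (m * p) + real (m * p)) / real p\<rfloor>)"
    (is "?L \<longleftrightarrow> ?R")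
proof
  assume R: ?R
  then have "p_complementary p {0..} x {1..} y"
    using assms by (intro p_complementary_floor_phi[of m]) auto
  then show ?L
    using R floor_phi_difference[OF \<open>p \<ge> 1\<close>] by simp
next
  assume L: ?L
  \<comment> \<open>The floor sequences form a second solution, to be identified with the given one
    by uniqueness; \<open>nat\<close> is harmless because the floors are non-negative.\<close>
  define x' where "x' n = nat \<lfloor>real n * phi (m * p) / real p\<rfloor>" for n
  define y' where "y' n = nat \<lfloor>real n * (phi (m * p) + real (m * p)) / real p\<rfloor>" for n
  have x': "int (x' n) = \<lfloor>real n * phi (m * p) / real p\<rfloor>" for n
    unfolding x'_def using phi_pos[of "m * p"] by simp
  have y': "int (y' n) = \<lfloor>real n * (phi (m * p) + real (m * p)) / real p\<rfloor>" for n
    unfolding y'_def using phi_pos[of "m * p"] by simp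
  have diff: "y n = x n + m * n" for n
  proof -
    have "int (y n) = int (x n + m * n)"
      using L by (simp add: algebra_simps)
    then show ?thesis by (simp only: of_nat_eq_iff)
  qed
  have diff': "y' n = x' n + m * n" for n
  proof -
    have "int (y' n) = int (x' n + m * n)"
      unfolding of_nat_add x' y' by (rule floor_phi_difference[OF \<open>p \<ge> 1\<close>])
    then show ?thesis by (simp only: of_nat_eq_iff)
  qed
  have "mono x'"
    unfolding x'_def using phi_pos[of "m * p"]
    by (intro monoI nat_mono floor_mono divide_right_mono mult_right_mono) auto
  moreover have "p_complementary p {0..} x' {1..} y'"
    using assms x' y' by (intro p_complementary_floor_phi[of m]) auto
  ultimately have "x n = x' n" for n
    using L diff diff' assms by (intro p_complementary_unique[of m x x' p y y']) auto
  then show ?R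
    using diff diff' x' y' by metis
qed

end
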